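(* Let $n\geq 2$ be an integer, let $w=(w_1,\ldots,w_n)\in\mathbb{R}^n$ with $w_i\neq 0$ for all $i\in\{1,\ldots,n\}$, and let $c\in\mathbb{R}$. Let $Z_1,\ldots,Z_n$ be i.i.d. standard Normal random variables, and set $X_i:=w_iZ_i$ for $i\in\{1,\ldots,n\}$. Then the conditional distribution of $(X_1,\ldots,X_{n-1})$ given $\sum_{i=1}^n X_i=c$ (equivalently, given $\sum_{i=1}^n w_iZ_i=c$) is the (non-degenerate) $(n-1)$-dimensional Normal distribution with mean vector $\mu=(\mu_1,\ldots,\mu_{n-1})$ and positive definite covariance matrix $\Sigma=(\Sigma_{i,j})_{1\le i,j\le n-1}$ given by $$\mu_i=\frac{c\,w_i^2}{\|w\|_2^2},\qquad \Sigma_{i,j}=\frac{w_i^2}{\|w\|_2^2}\left(\delta_{ij}\left(\|w\|_2^2-w_i^2\right)+(\delta_{ij}-1)w_j^2\right),\qquad i,j\in\{1,\ldots,n-1\}.$$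
   Context: Here $\|w\|_2:=\sqrt{\sum_{k=1}^n w_k^2}$ and $\delta_{ij}$ is the Kronecker delta. The conditional distribution given the (null) event $\sum_{i=1}^n X_i=c$ is understood in the sense of conditional densities: with $S:=\sum_{i=1}^n X_i$, it is the distribution on $\mathbb{R}^{n-1}$ with density $(x_1,\ldots,x_{n-1})\mapsto f_{X_1,\ldots,X_{n-1},S}(x_1,\ldots,x_{n-1},c)/f_S(c)$. Equivalently, the numerator is the joint density of $(X_1,\ldots,X_n)$ evaluated at $(x_1,\ldots,x_{n-1},\,c-\sum_{i=1}^{n-1}x_i)$, and $f_S$ is the density of the centered Normal distribution with variance $\|w\|_2^2$. *)

theory Defs
  imports
    "HOL-Probability.Probability"
    "Jordan_Normal_Form.Determinant"
    "Jordan_Normal_Form.Gauss_Jordan_Elimination"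
begin

text \<open>Points of \<open>\<real>\<^sup>k\<close> are extensional functions on \<open>{..<k}\<close>, so coordinates are counted from 0.\<close>

abbreviation lborel_Rn :: "nat \<Rightarrow> (nat \<Rightarrow> real) measure" where
  "lborel_Rn k \<equiv> PiM {..<k} (\<lambda>_. lborel)"

definition pos_def_mat :: "nat \<Rightarrow> real mat \<Rightarrow> bool" where
  "pos_def_mat k A \<longleftrightarrow>
     A \<in> carrier_mat k k \<and> transpose_mat A = A \<and>
     (\<forall>v \<in> carrier_vec k. v \<noteq> 0\<^sub>v k \<longrightarrow> scalar_prod v (A *\<^sub>v v) > 0)"

text \<open>
  The normal distribution with mean \<open>\<mu>\<close> and covariance matrix \<open>A\<close> on \<open>\<real>\<^sup>k\<close>; it is meaningful
  only if \<open>A\<close> is positive definite (then \<open>mat_inverse A\<close> is \<open>Some\<close> of the inverse).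
\<close>

definition mvnormal_density :: "nat \<Rightarrow> real vec \<Rightarrow> real mat \<Rightarrow> (nat \<Rightarrow> real) \<Rightarrow> real" where
  "mvnormal_density k \<mu> A x =
     (let v = Matrix.vec k x - \<mu>
      in exp (- scalar_prod v (the (mat_inverse A) *\<^sub>v v) / 2) / sqrt ((2 * pi) ^ k * Determinant.det A))"

definition mvnormal :: "nat \<Rightarrow> real vec \<Rightarrow> real mat \<Rightarrow> (nat \<Rightarrow> real) measure" where
  "mvnormal k \<mu> A = density (lborel_Rn k) (\<lambda>x. ennreal (mvnormal_density k \<mu> A x))"

text \<open>
  \<open>D\<close> is the conditional distribution of \<open>(X 0, \<dots>, X (k - 1))\<close> given \<open>S = c\<close>, in the sense of
  conditional densities: \<open>D\<close> has density \<open>x \<mapsto> f (x, c) / g c\<close>, where \<open>f\<close> and \<open>g\<close> are the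
  densities of \<open>(X 0, \<dots>, X (k - 1), S)\<close> and of \<open>S\<close>. Since densities are determined only almost
  everywhere and \<open>S = c\<close> may be a null event, \<open>f\<close> and \<open>g\<close> are required to be the continuous
  versions, which are unique. Continuity of \<open>f\<close> is with respect to the product topology.
\<close>

definition has_cond_distr ::
  "'a measure \<Rightarrow> nat \<Rightarrow> (nat \<Rightarrow> 'a \<Rightarrow> real) \<Rightarrow> ('a \<Rightarrow> real) \<Rightarrow> real \<Rightarrow> (nat \<Rightarrow> real) measure \<Rightarrow> bool"
where
  "has_cond_distr M k X S c D \<longleftrightarrow>
     (\<exists>(f :: (nat \<Rightarrow> real) \<times> real \<Rightarrow> real) (g :: real \<Rightarrow> real).
        distributed M (lborel_Rn k \<Otimes>\<^sub>M lborel) (\<lambda>\<omega>. (\<lambda>i\<in>{..<k}. X i \<omega>, S \<omega>)) (\<lambda>z. ennreal (f z)) \<and>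
        (\<forall>z \<in> space (lborel_Rn k \<Otimes>\<^sub>M lborel). 0 \<le> f z) \<and>
        continuous_on (space (lborel_Rn k \<Otimes>\<^sub>M lborel)) f \<and>
        distributed M lborel S (\<lambda>s. ennreal (g s)) \<and>
        (\<forall>s. 0 \<le> g s) \<and>
        continuous_on UNIV g \<and>
        0 < g c \<and>
        D = density (lborel_Rn k) (\<lambda>x. ennreal (f (x, c) / g c)))"

end

theory Submission
  imports Defs
begin

text \<open>
  Write \<open>k = n - 1\<close>, \<open>d i = (w i)\<^sup>2\<close> for the variances of the \<open>X i\<close>, \<open>t = d k\<close> for the last one and
  \<open>s = t + (\<Sum>i<k. d i)\<close> for the variance of the sum \<open>S\<close>. With \<open>D = diag (d 0, \<dots>, d (k - 1))\<close> the
  covariance matrix in the theorem is the rank-one perturbation \<open>\<Sigma> = D - d d\<^sup>T / s\<close>, and everything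
  that the normal density needs from it is explicit:

  \<^item> \<open>\<Sigma>\<close> is positive definite by the Cauchy-Schwarz inequality, because \<open>s\<close> exceeds the sum of the \<open>d i\<close>
    (\<open>pos_def_cond_cov\<close>);
  \<^item> its inverse is \<open>diag (1 / d i) + 1 1\<^sup>T / t\<close> (\<open>cond_cov_mult_cond_prec\<close>);
  \<^item> its determinant is \<open>(\<Prod>i<k. d i) * t / s\<close>, a Schur complement computation (\<open>det_cond_cov\<close>).

  On the probabilistic side, independence gives the joint density of all the \<open>X i\<close> as a product
  (\<open>distributed_PiM_indep\<close>). Separating the last coordinate and applying the volume-preserving
  shear \<open>(x, y) \<mapsto> (x, (\<Sum>i<k. x i) + y)\<close> shows that \<open>(X 0, \<dots>, X (k - 1), S)\<close> has the density
  \<open>(x, y) \<mapsto> (\<Prod>i<k. N (0, d i) (x i)) * N (0, t) (y - (\<Sum>i<k. x i))\<close>, which is visibly continuous, while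
  \<open>S\<close> has density \<open>N (0, s)\<close>. The quotient at \<open>y = c\<close> is the asserted normal density: the inverse of \<open>\<Sigma>\<close>
  turns the exponents into a completed square (\<open>conditional_normal_exponent\<close>), and the determinant
  matches the normalising constants (\<open>conditional_normal_density\<close>).
\<close>

section \<open>The conditional covariance matrix\<close>

text \<open>
  If \<open>d i\<close> are the variances of the first \<open>k\<close> of some independent normal variables and \<open>s\<close> is the variance
  of the sum of all of them, this is the covariance of those \<open>k\<close> variables conditioned on the sum.
\<close>

definition cond_cov :: "nat \<Rightarrow> (nat \<Rightarrow> real) \<Rightarrow> real \<Rightarrow> real mat" where
  "cond_cov k d s = Matrix.mat k k (\<lambda>(i, j). of_bool (i = j) * d i - d i * d j / s)"

text \<open>
  The matching precision matrix. Its quadratic form is \<open>- 2\<close> times the exponent of the unconditioned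
  centered density at a point whose coordinates sum to zero: the coordinate of variance \<open>t\<close> that is
  not listed is minus the sum of the listed ones, whence the constant \<open>1 / t\<close> in every entry.
\<close>

definition cond_prec :: "nat \<Rightarrow> (nat \<Rightarrow> real) \<Rightarrow> real \<Rightarrow> real mat" where
  "cond_prec k d t = Matrix.mat k k (\<lambda>(i, j). of_bool (i = j) / d i + 1 / t)"

lemma sum_of_bool_mult:
  fixes f :: "nat \<Rightarrow> 'a :: semiring_1"
  assumes "i < k"
  shows "(\<Sum>l<k. of_bool (i = l) * f l) = f i" "(\<Sum>l<k. of_bool (l = i) * f l) = f i"
proof -
  have "(\<Sum>l<k. of_bool (i = l) * f l) = (\<Sum>l\<in>{i}. of_bool (i = l) * f l)"
    using assms by (intro sum.mono_neutral_right) auto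
  then show "(\<Sum>l<k. of_bool (i = l) * f l) = f i" by simp
  then show "(\<Sum>l<k. of_bool (l = i) * f l) = f i" by (simp add: eq_commute[of _ i])
qed

lemma det_diagonal_fun:
  fixes d :: "nat \<Rightarrow> 'a :: idom"
  shows "Determinant.det (Matrix.mat k k (\<lambda>(i, j). of_bool (i = j) * d i)) = (\<Prod>i<k. d i)"
proof -
  let ?D = "Matrix.mat k k (\<lambda>(i, j). of_bool (i = j) * d i)"
  have "Determinant.det ?D = prod_list (diag_mat ?D)"
    by (rule det_upper_triangular) auto
  also have "diag_mat ?D = map d [0..<k]"
    by (auto simp: diag_mat_def)
  finally show ?thesis
    by (simp add: prod.distinct_set_conv_list[symmetric] atLeast0LessThan)
qed

text \<open>
  \<open>cond_cov k d s\<close> is the Schur complement of the corner \<open>s\<close> in the covariance matrix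
  \<open>C = (D, d; d\<^sup>T, s)\<close> of the first \<open>k\<close> variables and the total. Eliminating with the corner gives
  \<open>det C\<close> as \<open>s\<close> times the determinant in question; eliminating with \<open>D\<close> gives it as \<open>t\<close> times \<open>det D\<close>,
  where \<open>t = s - (\<Sum>i<k. d i)\<close>. Both eliminations appear below as block triangular factorisations of \<open>C\<close>.
\<close>

lemma det_cond_cov:
  assumes "s \<noteq> 0"
  shows "Determinant.det (cond_cov k d s) = (\<Prod>i<k. d i) * (s - (\<Sum>i<k. d i)) / s"
proof -
  define D where "D = Matrix.mat k k (\<lambda>(i, j). of_bool (i = j) * d i)"
  define col where "col = (\<lambda>f. Matrix.mat k 1 (\<lambda>(i, j). f i :: real))"
  define row where "row = (\<lambda>f. Matrix.mat 1 k (\<lambda>(i, j). f j :: real))"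
  define sgl where "sgl = (\<lambda>a. Matrix.mat 1 1 (\<lambda>_. a :: real))"
  define t where "t = s - (\<Sum>i<k. d i)"
  have carrier [simp]: "D \<in> carrier_mat k k" "col f \<in> carrier_mat k 1" "row f \<in> carrier_mat 1 k"
    "sgl a \<in> carrier_mat 1 1" "cond_cov k d s \<in> carrier_mat k k" for f a
    by (simp_all add: D_def col_def row_def sgl_def cond_cov_def)
  have det_sgl: "Determinant.det (sgl a) = a" for a
    by (simp add: sgl_def det_single)
  have det_D: "Determinant.det D = (\<Prod>i<k. d i)"
    unfolding D_def by (rule det_diagonal_fun)
  define C where "C = four_block_mat D (col d) (row d) (sgl s)"
  have "four_block_mat (1\<^sub>m k) (0\<^sub>m k 1) (row (\<lambda>_. 1)) (sgl 1) * four_block_mat D (col d) (0\<^sub>m 1 k) (sgl t) =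
      four_block_mat (1\<^sub>m k * D + 0\<^sub>m k 1 * 0\<^sub>m 1 k) (1\<^sub>m k * col d + 0\<^sub>m k 1 * sgl t)
        (row (\<lambda>_. 1) * D + sgl 1 * 0\<^sub>m 1 k) (row (\<lambda>_. 1) * col d + sgl 1 * sgl t)"
    by (rule mult_four_block_mat[OF one_carrier_mat zero_carrier_mat carrier(3,4,1,2) zero_carrier_mat carrier(4)])
  also have "1\<^sub>m k * D + 0\<^sub>m k 1 * 0\<^sub>m 1 k = D"
    by (rule eq_matI) (auto simp: D_def)
  also have "1\<^sub>m k * col d + 0\<^sub>m k 1 * sgl t = col d"
    by (rule eq_matI) (auto simp: col_def sgl_def)
  also have "row (\<lambda>_. 1) * D + sgl 1 * 0\<^sub>m 1 k = row d"
    by (rule eq_matI) (auto simp: row_def sgl_def D_def scalar_prod_def atLeast0LessThan sum_of_bool_mult)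
  also have "row (\<lambda>_. 1) * col d + sgl 1 * sgl t = sgl s"
    by (rule eq_matI) (auto simp: row_def col_def sgl_def t_def scalar_prod_def atLeast0LessThan)
  finally have C1: "C = four_block_mat (1\<^sub>m k) (0\<^sub>m k 1) (row (\<lambda>_. 1)) (sgl 1) *
                        four_block_mat D (col d) (0\<^sub>m 1 k) (sgl t)"
    by (simp add: C_def)
  have "four_block_mat (cond_cov k d s) (col (\<lambda>i. d i / s)) (0\<^sub>m 1 k) (sgl 1) *
        four_block_mat (1\<^sub>m k) (0\<^sub>m k 1) (row d) (sgl s) =
      four_block_mat (cond_cov k d s * 1\<^sub>m k + col (\<lambda>i. d i / s) * row d)
        (cond_cov k d s * 0\<^sub>m k 1 + col (\<lambda>i. d i / s) * sgl s)
        (0\<^sub>m 1 k * 1\<^sub>m k + sgl 1 * row d) (0\<^sub>m 1 k * 0\<^sub>m k 1 + sgl 1 * sgl s)"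
    by (rule mult_four_block_mat[OF carrier(5,2) zero_carrier_mat carrier(4) one_carrier_mat zero_carrier_mat carrier(3,4)])
  also have "cond_cov k d s * 1\<^sub>m k + col (\<lambda>i. d i / s) * row d = D"
    by (rule eq_matI) (auto simp: D_def col_def row_def cond_cov_def scalar_prod_def)
  also have "cond_cov k d s * 0\<^sub>m k 1 + col (\<lambda>i. d i / s) * sgl s = col d"
    using assms by (intro eq_matI) (auto simp: col_def sgl_def cond_cov_def scalar_prod_def)
  also have "0\<^sub>m 1 k * 1\<^sub>m k + sgl 1 * row d = row d"
    by (rule eq_matI) (auto simp: row_def sgl_def scalar_prod_def)
  also have "0\<^sub>m 1 k * 0\<^sub>m k 1 + sgl 1 * sgl s = sgl s"
    by (rule eq_matI) (auto simp: sgl_def scalar_prod_def)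
  finally have C2: "C = four_block_mat (cond_cov k d s) (col (\<lambda>i. d i / s)) (0\<^sub>m 1 k) (sgl 1) *
                        four_block_mat (1\<^sub>m k) (0\<^sub>m k 1) (row d) (sgl s)"
    by (simp add: C_def)
  have "Determinant.det C = (\<Prod>i<k. d i) * t"
    unfolding C1 by (simp add: det_mult[where n = "k + 1"]
      det_four_block_mat_upper_right_zero[where n = k and m = 1]
      det_four_block_mat_lower_left_zero[where n = k and m = 1] det_sgl det_D del: One_nat_def)
  moreover have "Determinant.det C = Determinant.det (cond_cov k d s) * s"
    unfolding C2 by (simp add: det_mult[where n = "k + 1"]
      det_four_block_mat_upper_right_zero[where n = k and m = 1]
      det_four_block_mat_lower_left_zero[where n = k and m = 1] det_sgl del: One_nat_def)
  ultimately show ?thesis using assms by (simp add: t_def field_simps)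
qed

text \<open>
  This is the Sherman-Morrison formula for \<open>D - d d\<^sup>T / s\<close>: since \<open>D\<^sup>-\<^sup>1 d\<close> is the all-ones vector,
  the correction to \<open>D\<^sup>-\<^sup>1\<close> is a constant matrix.
\<close>

lemma cond_cov_mult_cond_prec:
  assumes "\<And>i. i < k \<Longrightarrow> d i \<noteq> 0" "t \<noteq> 0" "s \<noteq> 0" "s = t + (\<Sum>i<k. d i)"
  shows "cond_cov k d s * cond_prec k d t = 1\<^sub>m k"
proof (rule eq_matI)
  fix i j assume "i < dim_row (1\<^sub>m k)" "j < dim_col (1\<^sub>m k)"
  then have ij: "i < k" "j < k" by auto
  have "(cond_cov k d s * cond_prec k d t) $$ (i, j) =
        (\<Sum>l<k. (of_bool (i = l) * d i - d i * d l / s) * (of_bool (l = j) / d l + 1 / t))"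
    using ij by (simp add: cond_cov_def cond_prec_def scalar_prod_def atLeast0LessThan)
  also have "\<dots> = (\<Sum>l<k. of_bool (i = l) * (of_bool (l = j) + d i / t) - of_bool (l = j) * (d i / s)
                      - d i / (s * t) * d l)"
  proof (intro sum.cong refl)
    fix l assume "l \<in> {..<k}"
    then have "d l \<noteq> 0" using assms(1) by simp
    then show "(of_bool (i = l) * d i - d i * d l / s) * (of_bool (l = j) / d l + 1 / t) =
      of_bool (i = l) * (of_bool (l = j) + d i / t) - of_bool (l = j) * (d i / s) - d i / (s * t) * d l"
      using assms(2,3) by (cases "i = l"; cases "l = j") (auto simp: divide_simps algebra_simps)
  qed
  also have "\<dots> = of_bool (i = j) + d i / t - d i / s - d i / (s * t) * (s - t)"
    using ij assms(4)
    by (simp only: sum_subtractf sum_distrib_left[symmetric] sum_of_bool_mult add_diff_cancel_left')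
  also have "\<dots> = of_bool (i = j)"
    using assms(2,3) by (simp add: field_simps)
  finally show "(cond_cov k d s * cond_prec k d t) $$ (i, j) = 1\<^sub>m k $$ (i, j)"
    using ij by simp
qed (auto simp: cond_cov_def cond_prec_def)

lemma mat_inverse_eqI:
  fixes A B :: "'a :: field mat"
  assumes A: "A \<in> carrier_mat k k" and B: "B \<in> carrier_mat k k" and AB: "A * B = 1\<^sub>m k"
  shows "mat_inverse A = Some B"
proof -
  have BA: "B * A = 1\<^sub>m k" using mat_mult_left_right_inverse[OF A B AB] .
  have "A \<in> Units (ring_mat TYPE('a) k ())"
    using A B AB BA unfolding Units_def by (auto simp: ring_mat_def)
  with mat_inverse(1)[OF A, of "()"] obtain C where C: "mat_inverse A = Some C" by blast
  note CC = mat_inverse(2)[OF A C]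
  have "B = (C * A) * B" using CC B by simp
  also have "\<dots> = C * (A * B)" using A B CC by (metis assoc_mult_mat)
  also have "\<dots> = C" using CC AB by (metis right_mult_one_mat)
  finally show ?thesis using C by simp
qed

lemma pos_def_cond_cov:
  assumes d: "\<And>i. i < k \<Longrightarrow> d i > 0" and s: "s > (\<Sum>i<k. d i)"
  shows "pos_def_mat k (cond_cov k d s)"
  unfolding pos_def_mat_def
proof (intro conjI ballI impI)
  show "transpose_mat (cond_cov k d s) = cond_cov k d s"
    by (rule eq_matI) (auto simp: cond_cov_def)
next
  fix v :: "real Matrix.vec" assume v: "v \<in> carrier_vec k" "v \<noteq> 0\<^sub>v k"
  let ?a = "\<lambda>i. vec_index v i"
  let ?Q = "\<Sum>i<k. d i * (?a i)\<^sup>2"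
  have s0: "s > 0" using s sum_nonneg[of "{..<k}" d] d by (force simp: less_imp_le)
  have row: "vec_index (cond_cov k d s *\<^sub>v v) i = d i * ?a i - d i / s * (\<Sum>j<k. d j * ?a j)" if "i < k" for i
  proof -
    have "vec_index (cond_cov k d s *\<^sub>v v) i = (\<Sum>j<k. (of_bool (i = j) * d i - d i * d j / s) * ?a j)"
      using that v(1) by (auto simp: cond_cov_def scalar_prod_def atLeast0LessThan)
    also have "\<dots> = (\<Sum>j<k. of_bool (i = j) * (d i * ?a i) - d i / s * (d j * ?a j))"
      by (intro sum.cong refl) (auto simp: field_simps)
    also have "\<dots> = d i * ?a i - d i / s * (\<Sum>j<k. d j * ?a j)"
      using that by (simp only: sum_subtractf sum_distrib_left[symmetric] sum_of_bool_mult)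
    finally show ?thesis .
  qed
  have "scalar_prod v (cond_cov k d s *\<^sub>v v) = (\<Sum>i<k. ?a i * (d i * ?a i - d i / s * (\<Sum>j<k. d j * ?a j)))"
    unfolding scalar_prod_def using row by (simp add: cond_cov_def atLeast0LessThan)
  also have "\<dots> = ?Q - (\<Sum>j<k. d j * ?a j)\<^sup>2 / s"
    by (simp add: sum_subtractf algebra_simps power2_eq_square sum_divide_distrib sum_distrib_left sum_distrib_right)
  also have "\<dots> > 0"
  proof -
    obtain i where i: "i < k" "?a i \<noteq> 0" using v by (metis carrier_vecD eq_vecI index_zero_vec)
    then have Q: "?Q > 0"
      using d by (intro sum_pos2[of _ i]) (auto simp: less_imp_le)
    \<comment> \<open>Cauchy-Schwarz with the weights \<open>d j\<close> split evenly between the two factors\<close>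
    have "(\<Sum>j<k. d j * ?a j)\<^sup>2 = (\<Sum>j<k. sqrt (d j) * (sqrt (d j) * ?a j))\<^sup>2"
      using d by (simp add: mult.assoc[symmetric] less_imp_le)
    also have "\<dots> \<le> (\<Sum>j<k. (sqrt (d j))\<^sup>2) * (\<Sum>j<k. (sqrt (d j) * ?a j)\<^sup>2)"
      by (rule Cauchy_Schwarz_ineq_sum)
    also have "\<dots> = (\<Sum>j<k. d j) * ?Q"
      using d by (simp add: power_mult_distrib less_imp_le)
    also have "\<dots> < s * ?Q" using s Q by simp
    finally show ?thesis using s0 by (simp add: field_simps)
  qed
  finally show "scalar_prod v (cond_cov k d s *\<^sub>v v) > 0" .
qed (simp add: cond_cov_def)

lemma cond_prec_quadratic_form:
  assumes "v \<in> carrier_vec k"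
  shows "scalar_prod v (cond_prec k d t *\<^sub>v v) =
         (\<Sum>i<k. (vec_index v i)\<^sup>2 / d i) + (\<Sum>i<k. vec_index v i)\<^sup>2 / t"
proof -
  let ?a = "\<lambda>i. vec_index v i"
  have row: "vec_index (cond_prec k d t *\<^sub>v v) i = ?a i / d i + (\<Sum>j<k. ?a j) / t" if "i < k" for i
  proof -
    have "vec_index (cond_prec k d t *\<^sub>v v) i = (\<Sum>j<k. (of_bool (i = j) / d i + 1 / t) * ?a j)"
      using that assms by (auto simp: cond_prec_def scalar_prod_def atLeast0LessThan)
    also have "\<dots> = (\<Sum>j<k. of_bool (i = j) * (?a i / d i) + 1 / t * ?a j)"
      by (intro sum.cong refl) (auto simp: field_simps)
    also have "\<dots> = ?a i / d i + (\<Sum>j<k. ?a j) / t"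
      using that by (simp add: sum.distrib sum_of_bool_mult sum_divide_distrib[symmetric])
    finally show ?thesis .
  qed
  have "scalar_prod v (cond_prec k d t *\<^sub>v v) = (\<Sum>i<k. ?a i * (?a i / d i + (\<Sum>j<k. ?a j) / t))"
    unfolding scalar_prod_def using row by (simp add: cond_prec_def atLeast0LessThan)
  also have "\<dots> = (\<Sum>i<k. (?a i)\<^sup>2 / d i) + (\<Sum>i<k. ?a i)\<^sup>2 / t"
    by (simp add: distrib_left sum.distrib power2_eq_square sum_distrib_right[symmetric] sum_divide_distrib[symmetric])
  finally show ?thesis .
qed

section \<open>Transformations of densities\<close>

text \<open>
  On a box both measures factor over the coordinates, one by independence and the other by
  Tonelli's theorem; boxes determine a measure on the product.
\<close>

lemma (in prob_space) distributed_PiM_indep: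
  fixes X :: "'i \<Rightarrow> 'a \<Rightarrow> real" and f :: "'i \<Rightarrow> real \<Rightarrow> ennreal"
  assumes I: "finite I" "I \<noteq> {}"
    and ind: "indep_vars (\<lambda>_. lborel) X I"
    and X: "\<And>i. i \<in> I \<Longrightarrow> distributed M lborel (X i) (f i)"
  shows "distributed M (PiM I (\<lambda>_. lborel)) (\<lambda>\<omega>. \<lambda>i\<in>I. X i \<omega>) (\<lambda>x. \<Prod>i\<in>I. f i (x i))"
proof -
  interpret P: product_sigma_finite "\<lambda>_::'i. lborel :: real measure" ..
  have [measurable]: "X i \<in> borel_measurable M" "f i \<in> borel_measurable borel" if "i \<in> I" for i
    using distributed_measurable[OF X[OF that]] distributed_borel_measurable[OF X[OF that]] by auto
  have rv: "(\<lambda>\<omega>. \<lambda>i\<in>I. X i \<omega>) \<in> measurable M (PiM I (\<lambda>_. lborel))"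
    by (intro measurable_restrict) simp
  have fm[measurable]: "(\<lambda>x. \<Prod>i\<in>I. f i (x i)) \<in> borel_measurable (PiM I (\<lambda>_. lborel))"
    by measurable
  have "distr M (PiM I (\<lambda>_. lborel)) (\<lambda>\<omega>. \<lambda>i\<in>I. X i \<omega>) =
        density (PiM I (\<lambda>_. lborel)) (\<lambda>x. \<Prod>i\<in>I. f i (x i))"
  proof (rule measure_eqI_PiM_finite[OF I(1), where M = "\<lambda>_. lborel" and A = "\<lambda>_. Pi\<^sub>E I (\<lambda>_. UNIV)"])
    fix A :: "'i \<Rightarrow> real set" assume A: "\<And>i. i \<in> I \<Longrightarrow> A i \<in> sets lborel"
    note [measurable] = A
    have "emeasure (distr M (PiM I (\<lambda>_. lborel)) (\<lambda>\<omega>. \<lambda>i\<in>I. X i \<omega>)) (Pi\<^sub>E I A) =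
          emeasure M (\<Inter>i\<in>I. X i -` A i \<inter> space M)"
      using I by (subst emeasure_distr[OF rv])
        (auto intro!: sets_PiM_I_finite A arg_cong[where f = "emeasure M"])
    also have "\<dots> = (\<Prod>i\<in>I. emeasure M (X i -` A i \<inter> space M))"
      using indep_varsD_finite[OF ind I(2,1) A] by (simp add: emeasure_eq_measure prod_ennreal)
    also have "\<dots> = (\<Prod>i\<in>I. \<integral>\<^sup>+x. f i x * indicator (A i) x \<partial>lborel)"
      using X A by (intro prod.cong refl distributed_emeasure) auto
    also have "\<dots> = (\<integral>\<^sup>+x. (\<Prod>i\<in>I. f i (x i) * indicator (A i) (x i)) \<partial>PiM I (\<lambda>_. lborel))"
      using I by (intro P.product_nn_integral_prod[symmetric]) auto
    also have "\<dots> = (\<integral>\<^sup>+x. (\<Prod>i\<in>I. f i (x i)) * indicator (Pi\<^sub>E I A) x \<partial>PiM I (\<lambda>_. lborel))"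
    proof (intro nn_integral_cong)
      fix x :: "'i \<Rightarrow> real" assume "x \<in> space (PiM I (\<lambda>_. lborel))"
      then have "(\<Prod>i\<in>I. indicator (A i) (x i)) = (indicator (Pi\<^sub>E I A) x :: ennreal)"
        using I by (auto simp: space_PiM PiE_iff indicator_def prod.neutral)
      then show "(\<Prod>i\<in>I. f i (x i) * indicator (A i) (x i)) = (\<Prod>i\<in>I. f i (x i)) * indicator (Pi\<^sub>E I A) x"
        by (simp add: prod.distrib)
    qed
    also have "\<dots> = emeasure (density (PiM I (\<lambda>_. lborel)) (\<lambda>x. \<Prod>i\<in>I. f i (x i))) (Pi\<^sub>E I A)"
      using I by (intro emeasure_density[symmetric] fm sets_PiM_I_finite A) auto
    finally show "emeasure (distr M (PiM I (\<lambda>_. lborel)) (\<lambda>\<omega>. \<lambda>i\<in>I. X i \<omega>)) (Pi\<^sub>E I A) = \<dots>" .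
  next
    show "emeasure (distr M (PiM I (\<lambda>_. lborel)) (\<lambda>\<omega>. \<lambda>i\<in>I. X i \<omega>)) (Pi\<^sub>E I (\<lambda>_. UNIV)) \<noteq> \<infinity>" for i :: nat
      using prob_space_distr[OF rv] finite_measure.emeasure_finite prob_space.finite_measure
      by (metis infinity_ennreal_def)
  next
    show "range (\<lambda>_::nat. Pi\<^sub>E I (\<lambda>_. UNIV)) \<subseteq> prod_algebra I (\<lambda>_. lborel)"
      using prod_algebraI_finite[OF I(1), of "\<lambda>_. UNIV" "\<lambda>_. lborel"] by auto
  qed (auto simp: space_PiM)
  with rv fm show ?thesis by (simp add: distributed_def)
qed

text \<open>
  Gluing a coordinate onto a function identifies the binary product with the larger function space,
  measure included. A shear that changes only that coordinate can then be treated on a pair.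
\<close>

lemma (in product_sigma_finite) distributed_split_coordinate:
  assumes I: "finite I" "i \<notin> I" and W: "distributed N (PiM (insert i I) M) W f"
  shows "distributed N (PiM I M \<Otimes>\<^sub>M M i) (\<lambda>\<omega>. (restrict (W \<omega>) I, W \<omega> i)) (\<lambda>(x, y). f (x(i := y)))"
proof -
  note f[measurable] = distributed_borel_measurable[OF W]
  note m[measurable] = distributed_measurable[OF W]
  have upd[measurable]: "(\<lambda>(x, y). x(i := y)) \<in> measurable (PiM I M \<Otimes>\<^sub>M M i) (PiM (insert i I) M)"
    by (rule measurable_add_dim)
  have f2[measurable]: "(\<lambda>(x, y). f (x(i := y))) \<in> borel_measurable (PiM I M \<Otimes>\<^sub>M M i)"
    using measurable_compose[OF upd f] by (simp add: case_prod_beta)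
  have split[measurable]: "(\<lambda>z. (restrict z I, z i)) \<in> measurable (PiM (insert i I) M) (PiM I M \<Otimes>\<^sub>M M i)"
    by (intro measurable_Pair measurable_restrict_subset measurable_component_singleton) auto
  have rv[measurable]: "(\<lambda>\<omega>. (restrict (W \<omega>) I, W \<omega> i)) \<in> measurable N (PiM I M \<Otimes>\<^sub>M M i)"
    using measurable_compose[OF m split] .
  have "distr N (PiM I M \<Otimes>\<^sub>M M i) (\<lambda>\<omega>. (restrict (W \<omega>) I, W \<omega> i)) =
        density (PiM I M \<Otimes>\<^sub>M M i) (\<lambda>(x, y). f (x(i := y)))"
  proof (rule measure_eqI)
    fix A assume "A \<in> sets (distr N (PiM I M \<Otimes>\<^sub>M M i) (\<lambda>\<omega>. (restrict (W \<omega>) I, W \<omega> i)))"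
    then have A[measurable]: "A \<in> sets (PiM I M \<Otimes>\<^sub>M M i)" by simp
    have "emeasure (distr N (PiM I M \<Otimes>\<^sub>M M i) (\<lambda>\<omega>. (restrict (W \<omega>) I, W \<omega> i))) A =
          (\<integral>\<^sup>+\<omega>. indicator A (restrict (W \<omega>) I, W \<omega> i) \<partial>N)"
      using nn_integral_distr[OF rv, of "indicator A"] A by simp
    also have "\<dots> = (\<integral>\<^sup>+z. f z * indicator A (restrict z I, z i) \<partial>PiM (insert i I) M)"
      by (subst distributed_nn_integral[OF W]) measurable
    also have "\<dots> = (\<integral>\<^sup>+x. \<integral>\<^sup>+y. f (x(i := y)) * indicator A (restrict (x(i := y)) I, (x(i := y)) i) \<partial>M i \<partial>PiM I M)"
      using I by (intro product_nn_integral_insert) measurable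
    also have "\<dots> = (\<integral>\<^sup>+x. \<integral>\<^sup>+y. f (x(i := y)) * indicator A (x, y) \<partial>M i \<partial>PiM I M)"
    proof (intro nn_integral_cong)
      fix x y assume "x \<in> space (PiM I M)"
      then have "restrict (x(i := y)) I = x"
        using I by (auto simp: space_PiM PiE_iff extensional_def restrict_def fun_eq_iff)
      then show "f (x(i := y)) * indicator A (restrict (x(i := y)) I, (x(i := y)) i) =
        f (x(i := y)) * indicator A (x, y)" by simp
    qed
    also have "\<dots> = emeasure (density (PiM I M \<Otimes>\<^sub>M M i) (\<lambda>(x, y). f (x(i := y)))) A"
      by (subst emeasure_density[OF f2 A], subst M.nn_integral_fst[symmetric])
         (auto intro!: borel_measurable_times_ennreal f2)
    finally show "emeasure (distr N (PiM I M \<Otimes>\<^sub>M M i) (\<lambda>\<omega>. (restrict (W \<omega>) I, W \<omega> i))) A = \<dots>" .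
  qed simp
  with rv f2 show ?thesis by (simp add: distributed_def)
qed

text \<open>
  For fixed first coordinate the map is a translation of the line, so it preserves Lebesgue measure
  and has no Jacobian factor.
\<close>

lemma distributed_shear:
  fixes T :: "'a \<Rightarrow> real" and h :: "'b \<Rightarrow> real"
  assumes S: "sigma_finite_measure S" and h[measurable]: "h \<in> borel_measurable S"
    and YT: "distributed M (S \<Otimes>\<^sub>M lborel) (\<lambda>\<omega>. (Y \<omega>, T \<omega>)) f"
  shows "distributed M (S \<Otimes>\<^sub>M lborel) (\<lambda>\<omega>. (Y \<omega>, h (Y \<omega>) + T \<omega>)) (\<lambda>(y, s). f (y, s - h y))"
proof -
  interpret S: sigma_finite_measure S by fact
  interpret pair_sigma_finite S lborel ..
  note f[measurable] = distributed_borel_measurable[OF YT]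
  note m[measurable] = distributed_measurable[OF YT]
  have Y[measurable]: "Y \<in> measurable M S"
    using measurable_compose[OF m measurable_fst] by simp
  have T[measurable]: "T \<in> borel_measurable M"
    using measurable_compose[OF m measurable_snd] by simp
  have f2[measurable]: "(\<lambda>(y, s). f (y, s - h y)) \<in> borel_measurable (S \<Otimes>\<^sub>M lborel)"
    by measurable
  have rv[measurable]: "(\<lambda>\<omega>. (Y \<omega>, h (Y \<omega>) + T \<omega>)) \<in> measurable M (S \<Otimes>\<^sub>M lborel)"
    by measurable
  have "distr M (S \<Otimes>\<^sub>M lborel) (\<lambda>\<omega>. (Y \<omega>, h (Y \<omega>) + T \<omega>)) =
        density (S \<Otimes>\<^sub>M lborel) (\<lambda>(y, s). f (y, s - h y))"
  proof (rule measure_eqI)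
    fix A assume "A \<in> sets (distr M (S \<Otimes>\<^sub>M lborel) (\<lambda>\<omega>. (Y \<omega>, h (Y \<omega>) + T \<omega>)))"
    then have A[measurable]: "A \<in> sets (S \<Otimes>\<^sub>M lborel)" by simp
    have "emeasure (distr M (S \<Otimes>\<^sub>M lborel) (\<lambda>\<omega>. (Y \<omega>, h (Y \<omega>) + T \<omega>))) A =
          (\<integral>\<^sup>+\<omega>. indicator A (Y \<omega>, h (Y \<omega>) + T \<omega>) \<partial>M)"
      using nn_integral_distr[OF rv, of "indicator A"] A by simp
    also have "\<dots> = (\<integral>\<^sup>+z. f z * indicator A (fst z, h (fst z) + snd z) \<partial>(S \<Otimes>\<^sub>M lborel))"
      by (subst distributed_nn_integral[OF YT]) auto
    also have "\<dots> = (\<integral>\<^sup>+y. \<integral>\<^sup>+x. f (y, x) * indicator A (y, h y + x) \<partial>lborel \<partial>S)"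
      by (subst lborel.nn_integral_fst[symmetric]) auto
    also have "\<dots> = (\<integral>\<^sup>+y. \<integral>\<^sup>+s. f (y, s - h y) * indicator A (y, s) \<partial>lborel \<partial>S)"
    proof (rule nn_integral_cong)
      fix y assume [measurable]: "y \<in> space S"
      show "(\<integral>\<^sup>+x. f (y, x) * indicator A (y, h y + x) \<partial>lborel) =
            (\<integral>\<^sup>+s. f (y, s - h y) * indicator A (y, s) \<partial>lborel)"
        by (subst nn_integral_real_affine[where t = "- h y" and c = 1]) (auto simp: algebra_simps)
    qed
    also have "\<dots> = emeasure (density (S \<Otimes>\<^sub>M lborel) (\<lambda>(y, s). f (y, s - h y))) A"
      by (subst emeasure_density[OF f2 A], subst lborel.nn_integral_fst[symmetric])
         (auto intro!: borel_measurable_times_ennreal f2)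
    finally show "emeasure (distr M (S \<Otimes>\<^sub>M lborel) (\<lambda>\<omega>. (Y \<omega>, h (Y \<omega>) + T \<omega>))) A = \<dots>" .
  qed simp
  with rv f2 show ?thesis by (simp add: distributed_def)
qed

section \<open>Independent normal variables conditioned on their sum\<close>

text \<open>
  Completing the square. Conditioning distributes the value \<open>c\<close> of the sum proportionally to the
  variances, which makes \<open>c * d i / s\<close> the means; the subtracted term \<open>c\<^sup>2 / s\<close> comes from
  dividing by the density of the sum.
\<close>

lemma conditional_normal_exponent:
  fixes x d :: "nat \<Rightarrow> real" and c t s :: real
  assumes d: "\<And>i. i < k \<Longrightarrow> d i \<noteq> 0" and "t \<noteq> 0" "s \<noteq> 0" and s: "s = t + (\<Sum>i<k. d i)"
  shows "(\<Sum>i<k. (x i)\<^sup>2 / d i) + (c - (\<Sum>i<k. x i))\<^sup>2 / t - c\<^sup>2 / s =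
         (\<Sum>i<k. (x i - c * d i / s)\<^sup>2 / d i) + (\<Sum>i<k. x i - c * d i / s)\<^sup>2 / t"
proof -
  let ?x = "\<Sum>i<k. x i"
  have 1: "(\<Sum>i<k. x i - c * d i / s) = ?x - c * (s - t) / s"
    using s by (simp add: sum_subtractf sum_distrib_left sum_divide_distrib)
  have "(\<Sum>i<k. (x i - c * d i / s)\<^sup>2 / d i) =
        (\<Sum>i<k. (x i)\<^sup>2 / d i - 2 * c / s * x i + c\<^sup>2 / s\<^sup>2 * d i)"
    using d \<open>s \<noteq> 0\<close>
    by (intro sum.cong refl) (auto simp: power2_eq_square field_simps)
  also have "\<dots> = (\<Sum>i<k. (x i)\<^sup>2 / d i) - 2 * c / s * ?x + c\<^sup>2 / s\<^sup>2 * (s - t)"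
    using s by (simp only: sum.distrib sum_subtractf sum_distrib_left[symmetric] add_diff_cancel_left')
  finally have 2: "(\<Sum>i<k. (x i - c * d i / s)\<^sup>2 / d i) =
      (\<Sum>i<k. (x i)\<^sup>2 / d i) - 2 * c / s * ?x + c\<^sup>2 / s\<^sup>2 * (s - t)" .
  show ?thesis
    unfolding 1 2 using assms(2,3) by (simp add: divide_simps) (simp add: algebra_simps power2_eq_square)
qed

text \<open>
  The standard deviations are written \<open>w i\<close> even when these are negative: \<open>normal_density\<close> depends
  only on their squares.
\<close>

lemma conditional_normal_density:
  fixes x w :: "nat \<Rightarrow> real" and c :: real
  assumes w: "\<And>i. i \<le> k \<Longrightarrow> w i \<noteq> 0"
  defines "d \<equiv> \<lambda>i. (w i)\<^sup>2" and "s \<equiv> \<Sum>i<Suc k. (w i)\<^sup>2"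
  shows "(\<Prod>i<k. normal_density 0 (w i) (x i)) * normal_density 0 (w k) (c - (\<Sum>i<k. x i)) /
           normal_density 0 (sqrt s) c =
         mvnormal_density k (Matrix.vec k (\<lambda>i. c * d i / s)) (cond_cov k d s) x"
proof -
  define t where "t = d k"
  have d: "d i > 0" if "i < k" for i using w that by (simp add: d_def)
  have t: "t > 0" using w by (simp add: t_def d_def)
  have s: "s = t + (\<Sum>i<k. d i)" by (simp add: s_def t_def d_def)
  have s0: "s > 0" unfolding s using t d by (intro add_pos_nonneg sum_nonneg) (auto simp: less_imp_le)
  let ?v = "Matrix.vec k x - Matrix.vec k (\<lambda>i. c * d i / s)"
  let ?p = "\<Prod>i<k. d i"
  have inv: "mat_inverse (cond_cov k d s) = Some (cond_prec k d t)"
    using d t s s0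
    by (intro mat_inverse_eqI[of _ k] cond_cov_mult_cond_prec) (force simp: cond_cov_def cond_prec_def)+
  have quad: "scalar_prod ?v (cond_prec k d t *\<^sub>v ?v) =
      (\<Sum>i<k. (x i)\<^sup>2 / d i) + (c - (\<Sum>i<k. x i))\<^sup>2 / t - c\<^sup>2 / s"
    using d t s s0
    by (subst conditional_normal_exponent) (force simp: cond_prec_quadratic_form)+
  have det: "Determinant.det (cond_cov k d s) = ?p * t / s"
    using s0 s by (simp add: det_cond_cov)
  have nd: "normal_density 0 \<sigma> y = exp (- (y\<^sup>2 / \<sigma>\<^sup>2) / 2) / sqrt (2 * pi * \<sigma>\<^sup>2)" for \<sigma> y :: real
    by (simp add: normal_density_def)
  have sqrt_prod: "(\<Prod>i<k. sqrt (h i)) = sqrt (\<Prod>i<k. h i)" for h :: "nat \<Rightarrow> real"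
    by (induction k) (simp_all add: real_sqrt_mult)
  have first: "(\<Prod>i<k. normal_density 0 (w i) (x i)) =
        exp (- (\<Sum>i<k. (x i)\<^sup>2 / d i) / 2) / sqrt ((2 * pi) ^ k * ?p)"
  proof -
    have "- (\<Sum>i<k. h i) / 2 = (\<Sum>i<k. - h i / 2)" for h :: "nat \<Rightarrow> real"
      by (simp add: sum_negf sum_divide_distrib)
    then have "exp (- (\<Sum>i<k. (x i)\<^sup>2 / d i) / 2) = (\<Prod>i<k. exp (- ((x i)\<^sup>2 / d i) / 2))"
      by (simp only: exp_sum[symmetric] finite_lessThan)
    then show ?thesis
      by (simp add: nd d_def prod_dividef sqrt_prod prod.distrib)
  qed
  have last: "normal_density 0 (w k) (c - (\<Sum>i<k. x i)) =
        exp (- ((c - (\<Sum>i<k. x i))\<^sup>2 / t) / 2) / sqrt (2 * pi * t)"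
    by (simp add: nd t_def d_def)
  have total: "normal_density 0 (sqrt s) c = exp (- (c\<^sup>2 / s) / 2) / sqrt (2 * pi * s)"
    using s0 by (simp add: nd)
  have combine: "exp (- a / 2) / sqrt (q * ?p) * (exp (- b / 2) / sqrt (2 * pi * t)) /
      (exp (- e / 2) / sqrt (2 * pi * s)) = exp (- (a + b - e) / 2) / sqrt (q * (?p * t / s))"
    for a b e q :: real
  proof -
    have "exp (- (a + b - e) / 2) = exp (- a / 2) * exp (- b / 2) / exp (- e / 2)"
      by (simp add: exp_add[symmetric] exp_diff[symmetric] add_divide_distrib diff_divide_distrib)
    moreover have "sqrt (q * (?p * t / s)) = sqrt (q * ?p) * sqrt (2 * pi * t) / sqrt (2 * pi * s)"
      using s0 by (simp add: real_sqrt_mult real_sqrt_divide)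
    ultimately show ?thesis by simp
  qed
  show ?thesis
    unfolding mvnormal_density_def Let_def inv det option.sel quad first last total
    by (rule combine)
qed

lemma (in prob_space) has_cond_distr_independent_normals:
  fixes w :: "nat \<Rightarrow> real" and X :: "nat \<Rightarrow> 'a \<Rightarrow> real"
  assumes k: "k > 0" and w: "\<And>i. i \<le> k \<Longrightarrow> w i \<noteq> 0"
    and ind: "indep_vars (\<lambda>_. borel) X {..k}"
    and X: "\<And>i. i \<le> k \<Longrightarrow> distributed M lborel (X i) (\<lambda>x. ennreal (normal_density 0 (w i) x))"
  defines "d \<equiv> \<lambda>i. (w i)\<^sup>2" and "s \<equiv> \<Sum>i<Suc k. (w i)\<^sup>2"
  shows "has_cond_distr M k X (\<lambda>\<omega>. \<Sum>i<Suc k. X i \<omega>) c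
           (mvnormal k (Matrix.vec k (\<lambda>i. c * d i / s)) (cond_cov k d s))"
proof -
  interpret P: product_sigma_finite "\<lambda>_::nat. lborel :: real measure" ..
  interpret PF: finite_product_sigma_finite "\<lambda>_::nat. lborel :: real measure" "{..<k}"
    by standard simp
  let ?L = "lborel_Rn k"
  let ?F = "\<lambda>x. \<Prod>i<k. normal_density 0 (w i) (x i)"
  \<comment> \<open>the densities of the variables with their sum and of the sum, in their continuous versions\<close>
  define f where "f = (\<lambda>(x, y). ?F x * normal_density 0 (w k) (y - (\<Sum>i<k. x i)))"
  define g where "g = normal_density 0 (sqrt s)"
  have s0: "s > 0"
    unfolding s_def using w by (intro sum_pos) (auto simp: less_Suc_eq_le)
  have ind': "indep_vars (\<lambda>_. lborel) X {..k}"
    using indep_vars_compose2[OF ind, of "\<lambda>_ x. x" "\<lambda>_. lborel"] by simp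
  have "distributed M (PiM {..k} (\<lambda>_. lborel)) (\<lambda>\<omega>. \<lambda>i\<in>{..k}. X i \<omega>)
      (\<lambda>x. \<Prod>i\<le>k. ennreal (normal_density 0 (w i) (x i)))"
    using X by (intro distributed_PiM_indep ind') auto
  then have "distributed M (PiM (insert k {..<k}) (\<lambda>_. lborel)) (\<lambda>\<omega>. \<lambda>i\<in>{..k}. X i \<omega>)
      (\<lambda>x. \<Prod>i\<le>k. ennreal (normal_density 0 (w i) (x i)))"
    by (simp add: lessThan_Suc[symmetric] lessThan_Suc_atMost)
  from P.distributed_split_coordinate[OF _ _ this]
  have "distributed M (?L \<Otimes>\<^sub>M lborel) (\<lambda>\<omega>. (\<lambda>i\<in>{..<k}. X i \<omega>, X k \<omega>))
      (\<lambda>(x, y). (\<Prod>i<k. ennreal (normal_density 0 (w i) (x i))) * ennreal (normal_density 0 (w k) y))"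
    by (simp add: lessThan_Suc_atMost[symmetric] restrict_restrict Int_absorb1 subset_eq)
  then have "distributed M (?L \<Otimes>\<^sub>M lborel) (\<lambda>\<omega>. (\<lambda>i\<in>{..<k}. X i \<omega>, (\<Sum>i<k. (\<lambda>i\<in>{..<k}. X i \<omega>) i) + X k \<omega>))
      (\<lambda>(x, y). (\<lambda>(x, y). (\<Prod>i<k. ennreal (normal_density 0 (w i) (x i))) * ennreal (normal_density 0 (w k) y))
         (x, y - (\<Sum>i<k. x i)))"
    by (intro distributed_shear[OF PF.sigma_finite_measure_axioms]) measurable
  also have "(\<lambda>\<omega>. (\<lambda>i\<in>{..<k}. X i \<omega>, (\<Sum>i<k. (\<lambda>i\<in>{..<k}. X i \<omega>) i) + X k \<omega>)) =
             (\<lambda>\<omega>. (\<lambda>i\<in>{..<k}. X i \<omega>, \<Sum>i<Suc k. X i \<omega>))"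
    by simp
  also have "(\<lambda>(x, y). (\<lambda>(x, y). (\<Prod>i<k. ennreal (normal_density 0 (w i) (x i))) * ennreal (normal_density 0 (w k) y))
         (x, y - (\<Sum>i<k. x i))) = (\<lambda>z. ennreal (f z))"
    by (auto simp: f_def fun_eq_iff prod_ennreal ennreal_mult prod_nonneg)
  finally have joint: "distributed M (?L \<Otimes>\<^sub>M lborel) (\<lambda>\<omega>. (\<lambda>i\<in>{..<k}. X i \<omega>, \<Sum>i<Suc k. X i \<omega>)) (\<lambda>z. ennreal (f z))" .
  have "distributed M lborel (\<lambda>\<omega>. \<Sum>i<Suc k. X i \<omega>)
      (normal_density (\<Sum>i<Suc k. 0) (sqrt (\<Sum>i<Suc k. \<bar>w i\<bar>\<^sup>2)))"
    using ind w X
    by (intro sum_indep_normal) (auto simp: lessThan_Suc_atMost less_Suc_eq_le normal_density_def)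
  then have S: "distributed M lborel (\<lambda>\<omega>. \<Sum>i<Suc k. X i \<omega>) (\<lambda>y. ennreal (g y))"
    by (simp add: g_def s_def)
  have nd_cont: "continuous_on UNIV (normal_density 0 \<sigma>)" for \<sigma>
    unfolding normal_density_def by (cases "\<sigma> = 0") (auto intro!: continuous_intros)
  have coord: "continuous_on A (\<lambda>z :: (nat \<Rightarrow> real) \<times> real. fst z i)" for A i
    by (rule continuous_on_compose2[OF continuous_on_product_coordinates continuous_on_fst[OF continuous_on_id]]) auto
  have "continuous_on A f" for A
    unfolding f_def case_prod_beta
    by (intro continuous_intros continuous_on_compose2[OF nd_cont] coord) auto
  moreover have "density ?L (\<lambda>x. ennreal (f (x, c) / g c)) =
      mvnormal k (Matrix.vec k (\<lambda>i. c * d i / s)) (cond_cov k d s)"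
    unfolding mvnormal_def f_def g_def d_def s_def using conditional_normal_density[of k w, OF w] by simp
  moreover have "0 \<le> f z" for z
    by (auto simp: f_def case_prod_beta intro!: mult_nonneg_nonneg prod_nonneg)
  moreover have "g c > 0" "\<forall>y. 0 \<le> g y" "continuous_on UNIV g"
    using s0 nd_cont by (auto simp: g_def normal_density_pos)
  ultimately show ?thesis
    unfolding has_cond_distr_def using joint S by (intro exI[of _ f] exI[of _ g]) simp
qed

theorem mainTheorem1:
  fixes n :: nat and w :: "nat \<Rightarrow> real" and c :: real
    and M :: "'a measure" and Z X :: "nat \<Rightarrow> 'a \<Rightarrow> real"
    and \<mu> :: "real Matrix.vec" and \<Sigma> :: "real Matrix.mat"
  assumes "n \<ge> 2"
    and "\<And>i. i < n \<Longrightarrow> w i \<noteq> 0"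
    and "prob_space M"
    and "prob_space.indep_vars M (\<lambda>_. borel) Z {..<n}"
    and "\<And>i. i < n \<Longrightarrow> distributed M lborel (Z i) (\<lambda>x. ennreal (std_normal_density x))"
    and "\<And>i \<omega>. i < n \<Longrightarrow> X i \<omega> = w i * Z i \<omega>"
    and "\<mu> = Matrix.vec (n - 1) (\<lambda>i. c * (w i)\<^sup>2 / (L2_set w {..<n})\<^sup>2)"
    and "\<Sigma> = Matrix.mat (n - 1) (n - 1) (\<lambda>(i, j).
           (w i)\<^sup>2 / (L2_set w {..<n})\<^sup>2 *
           (of_bool (i = j) * ((L2_set w {..<n})\<^sup>2 - (w i)\<^sup>2) + (of_bool (i = j) - 1) * (w j)\<^sup>2))"
  shows "pos_def_mat (n - 1) \<Sigma> \<and>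
         has_cond_distr M (n - 1) X (\<lambda>\<omega>. \<Sum>i<n. X i \<omega>) c (mvnormal (n - 1) \<mu> \<Sigma>) \<and>
         has_cond_distr M (n - 1) X (\<lambda>\<omega>. \<Sum>i<n. w i * Z i \<omega>) c (mvnormal (n - 1) \<mu> \<Sigma>)"
proof -
  interpret prob_space M by fact
  define k where "k = n - 1"
  have n: "n = Suc k" and k: "k > 0" using assms(1) by (auto simp: k_def)
  define d where "d = (\<lambda>i. (w i)\<^sup>2)"
  define s where "s = (\<Sum>i<Suc k. (w i)\<^sup>2)"
  have d: "d i > 0" if "i \<le> k" for i using assms(2)[of i] that n by (simp add: d_def)
  have s0: "s > 0" unfolding s_def using d by (intro sum_pos) (auto simp: d_def less_Suc_eq_le)
  have L2: "(L2_set w {..<n})\<^sup>2 = s"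
    by (simp add: L2_set_def s_def n sum_nonneg)
  have \<mu>: "\<mu> = Matrix.vec k (\<lambda>i. c * d i / s)"
    unfolding assms(7) L2 by (simp add: n d_def)
  have \<Sigma>: "\<Sigma> = cond_cov k d s"
    unfolding assms(8) L2 cond_cov_def using s0
    by (intro eq_matI) (auto simp: n d_def field_simps)
  have "indep_vars (\<lambda>_. borel) (\<lambda>i \<omega>. w i * Z i \<omega>) {..<n}"
    by (rule indep_vars_compose2[OF assms(4)]) auto
  also have "?this \<longleftrightarrow> indep_vars (\<lambda>_. borel) X {..<n}"
    using assms(6) by (intro indep_vars_cong) auto
  finally have ind: "indep_vars (\<lambda>_. borel) X {..k}"
    by (simp add: n lessThan_Suc_atMost)
  have X: "distributed M lborel (X i) (\<lambda>x. ennreal (normal_density 0 (w i) x))" if "i \<le> k" for i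
  proof -
    have "X i = (\<lambda>\<omega>. 0 + w i * Z i \<omega>)" using assms(6)[of i] that n by auto
    moreover have "distributed M lborel (\<lambda>\<omega>. 0 + w i * Z i \<omega>) (normal_density (0 + w i * 0) (\<bar>w i\<bar> * 1))"
      using assms(2,5)[of i] that n by (intro normal_density_affine) auto
    ultimately show ?thesis by (simp add: normal_density_def)
  qed
  have "has_cond_distr M k X (\<lambda>\<omega>. \<Sum>i<n. X i \<omega>) c (mvnormal k \<mu> \<Sigma>)"
    unfolding \<mu> \<Sigma> n d_def s_def
    using assms(2) n by (intro has_cond_distr_independent_normals k ind X) auto
  moreover have "(\<lambda>\<omega>. \<Sum>i<n. X i \<omega>) = (\<lambda>\<omega>. \<Sum>i<n. w i * Z i \<omega>)"
    using assms(6) by auto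
  moreover have "pos_def_mat k \<Sigma>"
    unfolding \<Sigma> using d by (intro pos_def_cond_cov) (auto simp: s_def d_def)
  ultimately show ?thesis by (simp add: n)
qed

end
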